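(* Let $W$ be a Coxeter group with set $S$ of simple reflections. For every $w\in W$, $$\frac{\ell_T(w)+\ell_S(w)}{2} \leq \mathrm{dp}(w) \leq \ell_S(w).$$
   Context: $T=\{wsw^{-1}: w\in W, s\in S\}$ is the set of all reflections of $W$. $\ell_S(w)$ (length) and $\ell_T(w)$ (reflection length) are the minimal numbers of factors in an expression of $w$ as a product of elements of $S$, respectively of $T$. Let $\Phi=\Pi\cup(-\Pi)$ be the root system associated to $(W,S)$, with $\Pi$ the positive roots; each positive root $\beta$ corresponds to a reflection $t_\beta\in T$ with $t_\beta(\beta)=-\beta$, and $\beta\mapsto t_\beta$ is a bijection $\Pi\to T$. The depth of a positive root is $\mathrm{dp}(\beta)=\min\{k : s_1\cdots s_k(\beta)\in -\Pi \text{ for some } s_1,\dots,s_k\in S\}$. The depth of $w\in W$ is $$\mathrm{dp}(w)=\min\Big\{\sum_{i=1}^k \mathrm{dp}(\beta_i) : k\ge 0,\ w=t_{\beta_1}\cdots t_{\beta_k},\ \beta_i\in\Pi\Big\},$$ with the identity being the empty product. *)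

theory Defs
  imports Complex_Main "HOL-Algebra.Algebra"
begin

definition word_prod :: "('a, 'b) monoid_scheme \<Rightarrow> 'a list \<Rightarrow> 'a" where
  "word_prod W xs = foldr (\<otimes>\<^bsub>W\<^esub>) xs \<one>\<^bsub>W\<^esub>"

text \<open>\<open>cox_m W s t\<close> is the order of \<open>st\<close>; following the convention of \<^const>\<open>group.ord\<close>,
  the value \<open>0\<close> encodes infinite order.\<close>

definition cox_m :: "('a, 'b) monoid_scheme \<Rightarrow> 'a \<Rightarrow> 'a \<Rightarrow> nat" where
  "cox_m W s t = group.ord W (s \<otimes>\<^bsub>W\<^esub> t)"

text \<open>The equivalence on words over \<open>S\<close> generated by inserting and deleting the relators
  \<open>(st)\<^sup>m\<close>, where \<open>m = cox_m W s t\<close> is finite. The case \<open>s = t\<close> makes every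
  letter an involution, so formal inverses of letters are not needed.\<close>

inductive cox_equiv :: "('a, 'b) monoid_scheme \<Rightarrow> 'a set \<Rightarrow> 'a list \<Rightarrow> 'a list \<Rightarrow> bool"
  for W S where
  refl: "xs \<in> lists S \<Longrightarrow> cox_equiv W S xs xs"
| sym: "cox_equiv W S xs ys \<Longrightarrow> cox_equiv W S ys xs"
| trans: "cox_equiv W S xs ys \<Longrightarrow> cox_equiv W S ys zs \<Longrightarrow> cox_equiv W S xs zs"
| relator: "\<lbrakk>us \<in> lists S; vs \<in> lists S; s \<in> S; t \<in> S; cox_m W s t \<noteq> 0\<rbrakk>
    \<Longrightarrow> cox_equiv W S (us @ concat (replicate (cox_m W s t) [s, t]) @ vs) (us @ vs)"

text \<open>\<open>S\<close> is a set of involutions which, together with the relations \<open>(st)\<^sup>m = 1\<close>,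
  presents \<open>W\<close>. It is not required to be finite.\<close>

locale coxeter_system = group W for W :: "('a, 'b) monoid_scheme" (structure) +
  fixes S :: "'a set"
  assumes S_carrier: "S \<subseteq> carrier W"
    and S_order: "s \<in> S \<Longrightarrow> ord s = 2"
    and S_generates: "generate W S = carrier W"
    and S_presents: "\<lbrakk>xs \<in> lists S; ys \<in> lists S; word_prod W xs = word_prod W ys\<rbrakk>
      \<Longrightarrow> cox_equiv W S xs ys"

definition reflections :: "('a, 'b) monoid_scheme \<Rightarrow> 'a set \<Rightarrow> 'a set" where
  "reflections W S = {w \<otimes>\<^bsub>W\<^esub> s \<otimes>\<^bsub>W\<^esub> inv\<^bsub>W\<^esub> w | w s. w \<in> carrier W \<and> s \<in> S}"

definition word_length :: "('a, 'b) monoid_scheme \<Rightarrow> 'a set \<Rightarrow> 'a \<Rightarrow> nat" where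
  "word_length W A w = (LEAST n. \<exists>xs \<in> lists A. word_prod W xs = w \<and> length xs = n)"

definition cox_length :: "('a, 'b) monoid_scheme \<Rightarrow> 'a set \<Rightarrow> 'a \<Rightarrow> nat" where
  "cox_length W S w = word_length W S w"

definition reflection_length :: "('a, 'b) monoid_scheme \<Rightarrow> 'a set \<Rightarrow> 'a \<Rightarrow> nat" where
  "reflection_length W S w = word_length W (reflections W S) w"

text \<open>The representation space has the simple roots \<open>\<alpha>\<^sub>s\<close>, \<open>s \<in> S\<close>, as a basis. A vector is
  given by its coordinate function, which has finite support contained in \<open>S\<close>.\<close>

definition simple_root :: "'a \<Rightarrow> 'a \<Rightarrow> real" where
  "simple_root s = (\<lambda>t. if t = s then 1 else 0)"

definition cox_form_coeff :: "('a, 'b) monoid_scheme \<Rightarrow> 'a \<Rightarrow> 'a \<Rightarrow> real" where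
  "cox_form_coeff W s t = (if cox_m W s t = 0 then - 1 else - cos (pi / real (cox_m W s t)))"

definition cox_form :: "('a, 'b) monoid_scheme \<Rightarrow> ('a \<Rightarrow> real) \<Rightarrow> ('a \<Rightarrow> real) \<Rightarrow> real" where
  "cox_form W u v = (\<Sum>s | u s \<noteq> 0. \<Sum>t | v t \<noteq> 0. u s * v t * cox_form_coeff W s t)"

definition simple_refl :: "('a, 'b) monoid_scheme \<Rightarrow> 'a \<Rightarrow> ('a \<Rightarrow> real) \<Rightarrow> ('a \<Rightarrow> real)" where
  "simple_refl W s v = (\<lambda>t. v t - 2 * cox_form W (simple_root s) v * simple_root s t)"

definition word_act :: "('a, 'b) monoid_scheme \<Rightarrow> 'a list \<Rightarrow> ('a \<Rightarrow> real) \<Rightarrow> ('a \<Rightarrow> real)" where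
  "word_act W xs v = foldr (simple_refl W) xs v"

text \<open>\<open>w\<close> acts as \<open>s\<^sub>1 \<cdots> s\<^sub>k\<close> does, for any expression of \<open>w\<close> as a
  product of elements of \<open>S\<close>; the result does not depend on the expression.\<close>

definition cox_act :: "('a, 'b) monoid_scheme \<Rightarrow> 'a set \<Rightarrow> 'a \<Rightarrow> ('a \<Rightarrow> real) \<Rightarrow> ('a \<Rightarrow> real)" where
  "cox_act W S w v = (THE u. \<forall>xs \<in> lists S. word_prod W xs = w \<longrightarrow> word_act W xs v = u)"

definition roots :: "('a, 'b) monoid_scheme \<Rightarrow> 'a set \<Rightarrow> ('a \<Rightarrow> real) set" where
  "roots W S = {cox_act W S w (simple_root s) | w s. w \<in> carrier W \<and> s \<in> S}"

definition neg_root :: "('a \<Rightarrow> real) \<Rightarrow> ('a \<Rightarrow> real)" where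
  "neg_root \<beta> = (\<lambda>t. - \<beta> t)"

definition pos_roots :: "('a, 'b) monoid_scheme \<Rightarrow> 'a set \<Rightarrow> ('a \<Rightarrow> real) set" where
  "pos_roots W S = {\<beta> \<in> roots W S. \<forall>s. 0 \<le> \<beta> s}"

definition refl_of_root :: "('a, 'b) monoid_scheme \<Rightarrow> 'a set \<Rightarrow> ('a \<Rightarrow> real) \<Rightarrow> 'a" where
  "refl_of_root W S \<beta> = (THE t. t \<in> reflections W S \<and> cox_act W S t \<beta> = neg_root \<beta>)"

definition root_depth :: "('a, 'b) monoid_scheme \<Rightarrow> 'a set \<Rightarrow> ('a \<Rightarrow> real) \<Rightarrow> nat" where
  "root_depth W S \<beta> =
    (LEAST k. \<exists>xs \<in> lists S. length xs = k \<and> word_act W xs \<beta> \<in> neg_root ` pos_roots W S)"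

definition cox_depth :: "('a, 'b) monoid_scheme \<Rightarrow> 'a set \<Rightarrow> 'a \<Rightarrow> nat" where
  "cox_depth W S w =
    (LEAST n. \<exists>\<beta>s \<in> lists (pos_roots W S).
       w = word_prod W (map (refl_of_root W S) \<beta>s) \<and> n = sum_list (map (root_depth W S) \<beta>s))"

end

theory Submission
  imports Defs
begin

text \<open>If \<open>s\<^sub>1 \<cdots> s\<^sub>k(\<beta>)\<close> is negative with \<open>k\<close> minimal, then \<open>s\<^sub>2 \<cdots> s\<^sub>k(\<beta>)\<close> is positive but is made
  negative by \<open>s\<^sub>1\<close>, so it is the simple root of \<open>s\<^sub>1\<close> and
  \<open>t\<^sub>\<beta> = s\<^sub>k \<cdots> s\<^sub>2 s\<^sub>1 s\<^sub>2 \<cdots> s\<^sub>k\<close> has length at most \<open>2 dp(\<beta>) - 1\<close>. Summing over an expression of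
  \<open>w\<close> by \<open>n \<ge> \<ell>\<^sub>T(w)\<close> reflections of total depth \<open>dp(w)\<close> gives \<open>\<ell>\<^sub>S(w) \<le> 2 dp(w) - n\<close>. The upper bound
  holds because simple roots have depth \<open>1\<close>. All this rests on the geometric representation:
  \<open>w(\<alpha>\<^sub>s)\<close> is nonnegative if \<open>\<ell>\<^sub>S(ws) > \<ell>\<^sub>S(w)\<close>, which is proved by splitting off a longest possible
  suffix of \<open>w\<close> in a rank two parabolic subgroup.\<close>

section \<open>Words, their products and their lengths\<close>

lemma word_length_le:
  assumes "xs \<in> lists A"
  shows "word_length W A (word_prod W xs) \<le> length xs"
  unfolding word_length_def using assms by (intro Least_le) auto

lemma word_length_witness:
  assumes "xs \<in> lists A"
  shows "\<exists>ys \<in> lists A. word_prod W ys = word_prod W xs \<and> length ys = word_length W A (word_prod W xs)"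
  unfolding word_length_def by (rule LeastI_ex) (use assms in auto)

lemma word_prod_simps [simp]:
  "word_prod W [] = \<one>\<^bsub>W\<^esub>"
  "word_prod W (x # xs) = x \<otimes>\<^bsub>W\<^esub> word_prod W xs"
  by (auto simp: word_prod_def)

lemma word_act_simps [simp]:
  "word_act W [] v = v"
  "word_act W (x # xs) v = simple_refl W x (word_act W xs v)"
  "word_act W (xs @ ys) v = word_act W xs (word_act W ys v)"
  by (auto simp: word_act_def)

section \<open>Finitely supported vectors, linearity of the form and of the action\<close>

text \<open>A sum over an infinite set is 0 by default, so linearity of \<open>cox_form\<close> is
  stated for vectors of finite support.\<close>

definition finite_support :: "('a \<Rightarrow> real) \<Rightarrow> bool" where
  "finite_support v \<longleftrightarrow> finite {t. v t \<noteq> 0}"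

lemma finite_support_simple_root [simp]: "finite_support (simple_root s)"
  by (simp add: finite_support_def simple_root_def)

lemma finite_support_add:
  assumes "finite_support u" "finite_support v"
  shows "finite_support (\<lambda>x. u x + v x)"
proof -
  have "finite ({t. u t \<noteq> 0} \<union> {t. v t \<noteq> 0})"
    using assms unfolding finite_support_def by blast
  moreover have "{t. u t + v t \<noteq> 0} \<subseteq> {t. u t \<noteq> 0} \<union> {t. v t \<noteq> 0}" by force
  ultimately show ?thesis unfolding finite_support_def by (rule rev_finite_subset)
qed

lemma finite_support_scale:
  assumes "finite_support u"
  shows "finite_support (\<lambda>x. a * u x)"
  using assms unfolding finite_support_def by (rule rev_finite_subset) auto

lemma finite_support_diff:
  assumes "finite_support u" "finite_support v"
  shows "finite_support (\<lambda>x. u x - v x)"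
  using finite_support_add[OF assms(1) finite_support_scale[OF assms(2), of "-1"]] by simp

lemmas finite_support_intros =
  finite_support_add finite_support_scale finite_support_diff finite_support_simple_root

lemma cox_form_simple_root_left:
  "cox_form W (simple_root s) v = (\<Sum>t | v t \<noteq> 0. v t * cox_form_coeff W s t)"
proof -
  have "{x. simple_root s x \<noteq> 0} = {s}" by (auto simp: simple_root_def)
  then show ?thesis by (simp add: cox_form_def simple_root_def)
qed

text \<open>A common index set lets the forms of different vectors be added term by term; indices
  outside the support contribute 0.\<close>

lemma cox_form_simple_root_superset:
  assumes "finite A" "{t. v t \<noteq> 0} \<subseteq> A"
  shows "cox_form W (simple_root s) v = (\<Sum>t\<in>A. v t * cox_form_coeff W s t)"
  unfolding cox_form_simple_root_left
  by (rule sum.mono_neutral_left) (use assms in auto)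

lemma cox_form_simple_roots [simp]:
  "cox_form W (simple_root s) (simple_root t) = cox_form_coeff W s t"
  by (subst cox_form_simple_root_superset[of "{t}"]) (auto simp: simple_root_def)

lemma cox_form_lin:
  assumes "finite_support u" "finite_support v"
  shows "cox_form W (simple_root s) (\<lambda>x. a * u x + b * v x) =
    a * cox_form W (simple_root s) u + b * cox_form W (simple_root s) v"
proof -
  let ?A = "{t. u t \<noteq> 0} \<union> {t. v t \<noteq> 0}"
  have "finite ?A" using assms unfolding finite_support_def by blast
  then have "cox_form W (simple_root s) f = (\<Sum>t\<in>?A. f t * cox_form_coeff W s t)"
    if "f \<in> {u, v, \<lambda>x. a * u x + b * v x}" for f
    by (intro cox_form_simple_root_superset) (use that in auto)
  then show ?thesis
    by (simp add: sum_distrib_left sum.distrib algebra_simps)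
qed

lemma cox_form_add:
  assumes "finite_support u" "finite_support v"
  shows "cox_form W (simple_root s) (\<lambda>x. u x + v x) =
    cox_form W (simple_root s) u + cox_form W (simple_root s) v"
  using cox_form_lin[OF assms, of W s 1 1] by simp

lemma cox_form_scale:
  assumes "finite_support u"
  shows "cox_form W (simple_root s) (\<lambda>x. a * u x) = a * cox_form W (simple_root s) u"
  using cox_form_lin[OF assms assms, of W s a 0] by simp

lemma finite_support_simple_refl:
  "finite_support v \<Longrightarrow> finite_support (simple_refl W s v)"
  unfolding simple_refl_def by (intro finite_support_intros)

lemma finite_support_word_act:
  "finite_support v \<Longrightarrow> finite_support (word_act W xs v)"
  by (induction xs) (auto intro: finite_support_simple_refl)

lemma simple_refl_lin:
  assumes "finite_support u" "finite_support v"
  shows "simple_refl W s (\<lambda>x. a * u x + b * v x) =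
    (\<lambda>x. a * simple_refl W s u x + b * simple_refl W s v x)"
  by (auto simp: simple_refl_def cox_form_lin[OF assms] algebra_simps)

lemma word_act_lin:
  assumes "finite_support u" "finite_support v"
  shows "word_act W xs (\<lambda>x. a * u x + b * v x) =
    (\<lambda>x. a * word_act W xs u x + b * word_act W xs v x)"
  by (induction xs) (auto simp: simple_refl_lin finite_support_word_act assms)

section \<open>Alternating words in two letters\<close>

text \<open>The parity of the remaining length picks each letter, so a nonempty word ends in
  \<open>a\<close> whatever its length, and its suffixes have the same shape.\<close>

fun alternating :: "nat \<Rightarrow> 'a \<Rightarrow> 'a \<Rightarrow> 'a list" where
  "alternating 0 a b = []"
| "alternating (Suc n) a b = (if even n then a else b) # alternating n a b"

lemma length_alternating [simp]: "length (alternating n a b) = n"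
  by (induction n) auto

lemma alternating_in_lists: "a \<in> S \<Longrightarrow> b \<in> S \<Longrightarrow> alternating n a b \<in> lists S"
  by (induction n) auto

lemma alternating_snoc: "alternating n b a @ [a] = alternating (Suc n) a b"
  by (induction n) auto

lemma alternating_add: "\<exists>pre. alternating (i + j) a b = pre @ alternating j a b \<and> length pre = i
    \<and> set pre \<subseteq> {a, b}"
proof (induction i)
  case (Suc i)
  then obtain pre where "alternating (i + j) a b = pre @ alternating j a b" "length pre = i"
    "set pre \<subseteq> {a, b}" by blast
  then show ?case by (intro exI[of _ "(if even (i + j) then a else b) # pre"]) auto
qed auto

lemma alternating_double: "alternating (2 * n) a b = concat (replicate n [b, a])"
  by (induction n) auto

text \<open>With two letters available, a letter that differs from its right neighbour is forced by
  it, so the word can be read off from its last letter.\<close>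

lemma alternating_eqI:
  assumes "length ys = n" "ys \<in> lists {a, b}" "ys \<noteq> [] \<Longrightarrow> last ys = a"
    and "\<And>us x vs. ys \<noteq> us @ [x, x] @ vs"
  shows "ys = alternating n a b"
  using assms
proof (induction ys arbitrary: n)
  case (Cons y ys)
  have ys: "ys = alternating (length ys) a b"
  proof (rule Cons.IH)
    show "ys \<noteq> us @ [x, x] @ vs" for us x vs
      using Cons.prems(4)[of "y # us" x vs] by auto
  qed (use Cons.prems in auto)
  have "y = (if even (length ys) then a else b)"
  proof (cases ys)
    case Nil
    then show ?thesis using Cons.prems(3) by auto
  next
    case (Cons z zs)
    have "z # zs = alternating (Suc (length zs)) a b" using ys unfolding Cons by simp
    then have "z = (if even (length zs) then a else b)" by simp
    moreover have "y \<noteq> z" using Cons.prems(4)[of "[]" y zs] Cons by auto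
    ultimately show ?thesis using Cons.prems(2) Cons by (auto split: if_splits)
  qed
  then have "y # ys = alternating (Suc (length ys)) a b" using ys by (simp only: alternating.simps)
  then show ?case using Cons.prems(1) by (metis length_Cons)
qed simp

text \<open>The recursion followed by the coefficients of a simple root under alternating words;
  for \<open>c = cos \<theta>\<close> it gives \<open>sin (n\<theta>) / sin \<theta>\<close>.\<close>

fun cheb :: "real \<Rightarrow> nat \<Rightarrow> real" where
  "cheb c 0 = 0"
| "cheb c (Suc 0) = 1"
| "cheb c (Suc (Suc n)) = 2 * c * cheb c (Suc n) - cheb c n"

lemma cheb_one: "cheb 1 n = real n"
  by (induction "1 :: real" n rule: cheb.induct) auto

lemma two_cos_sin: "2 * cos y * sin x = sin (x + y) + sin (x - y)" for x y :: real
  by (simp add: sin_add sin_diff)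

text \<open>The recursion of \<open>cheb\<close> is that of sin(nt), by the product formula.
  Multiplying by \<open>sin t\<close> avoids a division.\<close>

lemma cheb_cos: "sin t * cheb (cos t) n = sin (real n * t)"
proof (induction "cos t" n rule: cheb.induct)
  case (3 n)
  have "sin t * cheb (cos t) (Suc (Suc n)) =
      2 * cos t * (sin t * cheb (cos t) (Suc n)) - sin t * cheb (cos t) n"
    by (simp add: algebra_simps)
  also have "\<dots> = 2 * cos t * sin (real (Suc n) * t) - sin (real n * t)"
    by (simp only: 3)
  also have "\<dots> = sin (real (Suc (Suc n)) * t)"
    unfolding two_cos_sin by (simp add: algebra_simps)
  finally show ?case .
qed auto

text \<open>For n \<le> m the angle n pi/m stays in [0, pi], where the sine is nonnegative, and m
  \<ge> 2 makes sin(pi/m) positive.\<close>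

lemma cheb_cos_nonneg:
  assumes "n \<le> m" "m \<ge> 2"
  shows "cheb (cos (pi / real m)) n \<ge> 0"
proof -
  have "0 < pi / real m" "pi / real m < pi" using assms by (auto simp: field_simps)
  then have "sin (pi / real m) > 0" by (rule sin_gt_zero)
  moreover have "sin (real n * (pi / real m)) \<ge> 0"
    by (rule sin_ge_zero) (use assms in \<open>auto simp: field_simps\<close>)
  ultimately show ?thesis
    unfolding cheb_cos[symmetric] by (simp add: zero_le_mult_iff)
qed

section \<open>Words and products in a Coxeter system\<close>

context coxeter_system
begin

lemma S_closed [simp]: "s \<in> S \<Longrightarrow> s \<in> carrier W"
  using S_carrier by auto

lemma word_prod_closed [simp]: "set xs \<subseteq> S \<Longrightarrow> word_prod W xs \<in> carrier W"
  by (induction xs) auto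

lemma word_prod_append:
  "set xs \<subseteq> carrier W \<Longrightarrow> set ys \<subseteq> carrier W \<Longrightarrow>
    word_prod W (xs @ ys) = word_prod W xs \<otimes> word_prod W ys"
proof (induction xs)
  case Nil
  moreover have "word_prod W ys \<in> carrier W" using Nil(2) by (induction ys) auto
  ultimately show ?case by simp
next
  case (Cons x xs)
  moreover have "word_prod W zs \<in> carrier W" if "set zs \<subseteq> carrier W" for zs
    using that by (induction zs) auto
  ultimately show ?case by (simp add: m_assoc)
qed

lemma word_prod_append_S [simp]:
  "set xs \<subseteq> S \<Longrightarrow> set ys \<subseteq> S \<Longrightarrow> word_prod W (xs @ ys) = word_prod W xs \<otimes> word_prod W ys"
  using S_carrier by (intro word_prod_append) auto

lemma S_square [simp]: "s \<in> S \<Longrightarrow> s \<otimes> s = \<one>"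
  using pow_ord_eq_1[of s] S_order[of s] by (simp add: numeral_2_eq_2)

lemma S_inv [simp]: "s \<in> S \<Longrightarrow> inv s = s"
  by (rule inv_equality) auto

lemma S_cancel_left [simp]: "s \<in> S \<Longrightarrow> x \<in> carrier W \<Longrightarrow> s \<otimes> (s \<otimes> x) = x"
  by (simp add: m_assoc[symmetric])

lemma conj_inv_conj:
  assumes "g \<in> carrier W" "x \<in> carrier W"
  shows "inv g \<otimes> (g \<otimes> x \<otimes> inv g) \<otimes> g = x"
  using assms by (simp add: m_assoc) (simp add: m_assoc[symmetric])

lemma word_prod_rev: "set xs \<subseteq> S \<Longrightarrow> word_prod W (rev xs) = inv (word_prod W xs)"
  by (induction xs) (auto simp: inv_mult_group)

lemma word_exists:
  assumes "w \<in> carrier W"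
  shows "\<exists>xs \<in> lists S. word_prod W xs = w"
proof -
  have "w \<in> generate W S" using assms S_generates by simp
  then show ?thesis
  proof induction
    case one
    show ?case by (rule bexI[of _ "[]"]) auto
  next
    case (incl h)
    then show ?case by (intro bexI[of _ "[h]"]) auto
  next
    case (inv h)
    then show ?case by (intro bexI[of _ "[h]"]) auto
  next
    case (eng h1 h2)
    then obtain xs ys where "set xs \<subseteq> S" "set ys \<subseteq> S" "word_prod W xs = h1" "word_prod W ys = h2"
      by auto
    then show ?case by (intro bexI[of _ "xs @ ys"]) auto
  qed
qed

subsection \<open>The geometric representation\<close>

lemma cox_m_refl: "s \<in> S \<Longrightarrow> cox_m W s s = 1"
  unfolding cox_m_def using ord_eq_1[of \<one>] by simp

lemma cox_m_sym: "s \<in> S \<Longrightarrow> t \<in> S \<Longrightarrow> cox_m W t s = cox_m W s t"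
  unfolding cox_m_def using ord_inv[of "s \<otimes> t"] by (simp add: inv_mult_group)

lemma cox_m_ge_2:
  assumes "s \<in> S" "t \<in> S" "s \<noteq> t" "cox_m W s t \<noteq> 0"
  shows "cox_m W s t \<ge> 2"
proof -
  have "cox_m W s t \<noteq> 1"
  proof
    assume "cox_m W s t = 1"
    then have "s \<otimes> t = \<one>" using assms ord_eq_1[of "s \<otimes> t"] by (simp add: cox_m_def)
    then have "s = inv t" using assms by (metis S_closed inv_equality)
    then show False using assms by simp
  qed
  then show ?thesis using assms(4) by linarith
qed

lemma coeff_refl: "s \<in> S \<Longrightarrow> cox_form_coeff W s s = 1"
  by (simp add: cox_form_coeff_def cox_m_refl)

lemma coeff_sym: "s \<in> S \<Longrightarrow> t \<in> S \<Longrightarrow> cox_form_coeff W t s = cox_form_coeff W s t"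
  by (simp add: cox_form_coeff_def cox_m_sym)

text \<open>The part \<open>q\<close> orthogonal to \<open>\<alpha>\<^sub>s\<close> is fixed, so
  only the coefficient of \<open>\<alpha>\<^sub>s\<close> changes.\<close>

lemma simple_refl_plane:
  assumes "s \<in> S" "t \<in> S" "finite_support q" "cox_form W (simple_root s) q = 0"
  shows "simple_refl W s (\<lambda>x. q x + (a * simple_root s x + b * simple_root t x)) =
    (\<lambda>x. q x + ((- 2 * b * cox_form_coeff W s t - a) * simple_root s x + b * simple_root t x))"
proof -
  have "cox_form W (simple_root s) (\<lambda>x. q x + (a * simple_root s x + b * simple_root t x)) =
      a + b * cox_form_coeff W s t"
    using assms by (simp add: cox_form_add cox_form_scale finite_support_intros coeff_refl)
  then show ?thesis by (auto simp: simple_refl_def algebra_simps)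
qed

lemma simple_refl_square:
  assumes "s \<in> S" "finite_support v"
  shows "simple_refl W s (simple_refl W s v) = v"
proof -
  let ?c = "cox_form W (simple_root s) v"
  \<comment> \<open>The reflection turns the form with \<open>\<alpha>\<^sub>s\<close> from c into c
    - 2c = -c, so the second reflection adds back what the first one subtracted.\<close>
  have "cox_form W (simple_root s) (\<lambda>x. 1 * v x + (- 2 * ?c) * simple_root s x) = - ?c"
    using assms by (subst cox_form_lin) (auto simp: coeff_refl)
  then have "cox_form W (simple_root s) (\<lambda>x. v x - 2 * ?c * simple_root s x) = - ?c"
    by (simp add: algebra_simps)
  then show ?thesis by (auto simp: simple_refl_def)
qed

text \<open>Trivial action of the defining relators is what makes the action of a group element
  independent of the word chosen for it.\<close>

lemma word_act_relator:
  assumes "s \<in> S" "t \<in> S" "cox_m W s t \<noteq> 0" "finite_support v"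
  shows "word_act W (concat (replicate (cox_m W s t) [s, t])) v = v"
proof (cases "s = t")
  case True
  then show ?thesis using assms by (simp add: cox_m_refl simple_refl_square)
next
  case False
  define m where "m = cox_m W s t"
  define h where "h = pi / real m"
  have m: "m \<ge> 2" unfolding m_def using cox_m_ge_2 assms False by blast
  then have "0 < h" "h < pi" by (auto simp: h_def field_simps)
  then have sin: "sin h > 0" by (rule sin_gt_zero)
  have st: "cox_form_coeff W s t = - cos h" and ts: "cox_form_coeff W t s = - cos h"
    using assms coeff_sym by (auto simp: cox_form_coeff_def h_def m_def)
  \<comment> \<open>Split \<open>v = q + p\<close> with \<open>p\<close> in the plane of \<open>\<alpha>\<^sub>s, \<alpha>\<^sub>t\<close> and \<open>q\<close> orthogonal to it;
    \<open>st\<close> fixes \<open>q\<close> and rotates the plane by \<open>2\<pi>/m\<close>.\<close>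
  define a b where "a = cox_form W (simple_root s) v" and "b = cox_form W (simple_root t) v"
  \<comment> \<open>These solve the linear system making \<open>v - p\<close> orthogonal to both
    roots; its Gram matrix has determinant 1 - cos^2 h = sin^2 h.\<close>
  define p1 p2 where "p1 = (a + cos h * b) / (sin h)\<^sup>2" and "p2 = (b + cos h * a) / (sin h)\<^sup>2"
  have p: "p1 - cos h * p2 = a" "p2 - cos h * p1 = b"
  proof -
    have num: "a + cos h * b - cos h * (b + cos h * a) = a * (sin h)\<^sup>2"
      "b + cos h * a - cos h * (a + cos h * b) = b * (sin h)\<^sup>2"
      by (simp_all only: sin_squared_eq) (simp_all add: algebra_simps power2_eq_square)
    have "p1 - cos h * p2 = (a + cos h * b - cos h * (b + cos h * a)) / (sin h)\<^sup>2"
      "p2 - cos h * p1 = (b + cos h * a - cos h * (a + cos h * b)) / (sin h)\<^sup>2"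
      by (simp_all add: p1_def p2_def diff_divide_distrib)
    then show "p1 - cos h * p2 = a" "p2 - cos h * p1 = b"
      unfolding num using sin by simp_all
  qed
  define q where "q = (\<lambda>x. 1 * v x + (-1) * (p1 * simple_root s x + p2 * simple_root t x))"
  have fq: "finite_support q" unfolding q_def using assms by (intro finite_support_intros)
  have qs: "cox_form W (simple_root s) q = 0" and qt: "cox_form W (simple_root t) q = 0"
    using assms p unfolding q_def
    by (simp_all only: cox_form_lin finite_support_intros cox_form_simple_roots st ts coeff_refl
         a_def[symmetric] b_def[symmetric]) (simp_all add: algebra_simps)
  \<comment> \<open>\<open>P k\<close> and \<open>Q k\<close> are to be the coefficients of
    \<open>\<alpha>\<^sub>s\<close> and \<open>\<alpha>\<^sub>t\<close> after \<open>k\<close>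
    applications of \<open>st\<close>, each advancing the angle by 2h. \<open>A\<close> and
    \<open>B\<close> are fitted to the values at k = 0.\<close>
  define A B where "A = p1 / sin h" and "B = - p2 / sin h"
  define P where "P k = A * sin (2 * real k * h + h) + B * sin (2 * real k * h)" for k :: nat
  define Q where "Q k = A * sin (2 * real k * h) + B * sin (2 * real k * h - h)" for k :: nat
  have PQ0: "P 0 = p1" "Q 0 = p2" using sin by (auto simp: P_def Q_def A_def B_def)
  have "real m * h = pi" using m by (simp add: h_def)
  then have full_turn: "2 * real m * h = 2 * pi" by simp
  have PQm: "P m = p1" "Q m = p2" unfolding P_def Q_def full_turn using sin
    by (simp_all add: sin_diff sin_add A_def B_def)
  \<comment> \<open>One application of \<open>st\<close> is two half-steps: \<open>t\<close>
    replaces \<open>Q k\<close> by \<open>Q (Suc k)\<close>, then \<open>s\<close> replaces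
    \<open>P k\<close> by \<open>P (Suc k)\<close>.\<close>
  have QS: "2 * P k * cos h - Q k = Q (Suc k)" for k
  proof -
    have "2 * cos h * sin (2 * real k * h + h) = sin (2 * real (Suc k) * h) + sin (2 * real k * h)"
      "2 * cos h * sin (2 * real k * h) = sin (2 * real (Suc k) * h - h) + sin (2 * real k * h - h)"
      unfolding two_cos_sin by (simp_all add: algebra_simps)
    then show ?thesis unfolding P_def Q_def by (simp add: algebra_simps) algebra
  qed
  have PS: "2 * Q (Suc k) * cos h - P k = P (Suc k)" for k
  proof -
    have "2 * cos h * sin (2 * real (Suc k) * h) =
        sin (2 * real (Suc k) * h + h) + sin (2 * real k * h + h)"
      "2 * cos h * sin (2 * real (Suc k) * h - h) =
        sin (2 * real (Suc k) * h) + sin (2 * real k * h)"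
      unfolding two_cos_sin by (simp_all add: algebra_simps)
    then show ?thesis unfolding P_def Q_def by (simp add: algebra_simps) algebra
  qed
  let ?p = "\<lambda>k x. q x + (P k * simple_root s x + Q k * simple_root t x)"
  have step: "simple_refl W s (simple_refl W t (?p k)) = ?p (Suc k)" for k
  proof -
    have "simple_refl W t (?p k) =
        simple_refl W t (\<lambda>x. q x + (Q k * simple_root t x + P k * simple_root s x))"
      by (simp add: add.commute)
    also have "\<dots> = (\<lambda>x. q x + (Q (Suc k) * simple_root t x + P k * simple_root s x))"
      using simple_refl_plane[OF assms(2,1) fq qt, of "Q k" "P k"] by (simp add: ts QS)
    also have "\<dots> = (\<lambda>x. q x + (P k * simple_root s x + Q (Suc k) * simple_root t x))"
      by (simp add: add.commute)
    finally show ?thesis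
      using simple_refl_plane[OF assms(1,2) fq qs, of "P k" "Q (Suc k)"] by (simp add: st PS)
  qed
  have "word_act W (concat (replicate k [s, t])) (?p 0) = ?p k" for k
    by (induction k) (simp_all add: step)
  moreover have "?p 0 = v" "?p m = v" by (auto simp: PQ0 PQm q_def)
  ultimately show ?thesis unfolding m_def[symmetric] by metis
qed

lemma cox_equiv_word_act:
  "cox_equiv W S xs ys \<Longrightarrow> finite_support v \<Longrightarrow> word_act W xs v = word_act W ys v"
  by (induction rule: cox_equiv.induct) (auto simp: word_act_relator finite_support_word_act)

text \<open>A relator has 2m letters, so inserting or deleting it preserves parity.\<close>

lemma cox_equiv_parity: "cox_equiv W S xs ys \<Longrightarrow> even (length xs) = even (length ys)"
  by (induction rule: cox_equiv.induct) (auto simp: length_concat sum_list_replicate)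

text \<open>The description in \<open>cox_act\<close> has a value because \<open>S_presents\<close>
  makes any two words for one element equivalent; it is unique because \<open>xs\<close> is itself
  such a word.\<close>

lemma cox_act_word:
  assumes "set xs \<subseteq> S" "finite_support v"
  shows "cox_act W S (word_prod W xs) v = word_act W xs v"
  unfolding cox_act_def
proof (rule the_equality)
  show "\<forall>ys\<in>lists S. word_prod W ys = word_prod W xs \<longrightarrow> word_act W ys v = word_act W xs v"
    using assms by (auto intro: cox_equiv_word_act S_presents)
  then show "u = word_act W xs v"
    if "\<forall>ys\<in>lists S. word_prod W ys = word_prod W xs \<longrightarrow> word_act W ys v = u" for u
    using that assms(1) by auto
qed

lemma word_obtain:
  assumes "w \<in> carrier W"
  obtains xs where "set xs \<subseteq> S" "word_prod W xs = w"
  using word_exists[OF assms] by auto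

lemma finite_support_cox_act [simp]:
  assumes "w \<in> carrier W" "finite_support v"
  shows "finite_support (cox_act W S w v)"
proof -
  obtain xs where "set xs \<subseteq> S" "word_prod W xs = w" using word_obtain[OF assms(1)] .
  then show ?thesis using cox_act_word[of xs v] assms(2) by (simp add: finite_support_word_act)
qed

lemma cox_act_one [simp]: "finite_support v \<Longrightarrow> cox_act W S \<one> v = v"
  using cox_act_word[of "[]" v] by simp

lemma cox_act_S: "s \<in> S \<Longrightarrow> finite_support v \<Longrightarrow> cox_act W S s v = simple_refl W s v"
  using cox_act_word[of "[s]" v] by simp

lemma cox_act_mult:
  assumes "u \<in> carrier W" "w \<in> carrier W" "finite_support v"
  shows "cox_act W S (u \<otimes> w) v = cox_act W S u (cox_act W S w v)"
proof -
  obtain xs where "set xs \<subseteq> S" "word_prod W xs = u" using word_obtain[OF assms(1)] .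
  moreover obtain ys where "set ys \<subseteq> S" "word_prod W ys = w" using word_obtain[OF assms(2)] .
  ultimately show ?thesis
    using assms(3) cox_act_word[of "xs @ ys" v] cox_act_word[of ys v]
      cox_act_word[of xs "word_act W ys v"] by (simp add: finite_support_word_act)
qed

lemma cox_act_lin:
  assumes "w \<in> carrier W" "finite_support u" "finite_support v"
  shows "cox_act W S w (\<lambda>x. a * u x + b * v x) =
    (\<lambda>x. a * cox_act W S w u x + b * cox_act W S w v x)"
proof -
  obtain xs where xs: "set xs \<subseteq> S" "word_prod W xs = w" using word_obtain[OF assms(1)] .
  have "finite_support (\<lambda>x. a * u x + b * v x)" using assms by (intro finite_support_intros)
  then show ?thesis
    using cox_act_word[OF xs(1)] xs(2) assms(2,3) word_act_lin[OF assms(2,3)] by simp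
qed

lemma cox_act_scale:
  assumes "w \<in> carrier W" "finite_support u"
  shows "cox_act W S w (\<lambda>x. a * u x) = (\<lambda>x. a * cox_act W S w u x)"
  using cox_act_lin[OF assms assms(2), of a 0] by simp

lemma cox_act_inv [simp]:
  assumes "w \<in> carrier W" "finite_support v"
  shows "cox_act W S (inv w) (cox_act W S w v) = v" "cox_act W S w (cox_act W S (inv w) v) = v"
  using assms by (simp_all add: cox_act_mult[symmetric])

lemma simple_refl_simple_root: "s \<in> S \<Longrightarrow> simple_refl W s (simple_root s) = neg_root (simple_root s)"
  by (auto simp: simple_refl_def coeff_refl neg_root_def)

lemma cox_act_neg:
  assumes "w \<in> carrier W" "finite_support v"
  shows "cox_act W S w (neg_root v) = neg_root (cox_act W S w v)"
  using cox_act_scale[OF assms, of "-1"] by (simp add: neg_root_def)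

subsection \<open>Length and positivity\<close>

abbreviation len :: "'a \<Rightarrow> nat" where "len \<equiv> cox_length W S"

lemma len_le: "set xs \<subseteq> S \<Longrightarrow> len (word_prod W xs) \<le> length xs"
  unfolding cox_length_def by (rule word_length_le) auto

lemma len_word:
  assumes "w \<in> carrier W"
  obtains xs where "set xs \<subseteq> S" "word_prod W xs = w" "length xs = len w"
proof -
  obtain ys where "set ys \<subseteq> S" "word_prod W ys = w" using word_obtain[OF assms] .
  then show ?thesis using word_length_witness[of ys S W] that unfolding cox_length_def by auto
qed

lemma len_mult_le:
  assumes "u \<in> carrier W" "v \<in> carrier W"
  shows "len (u \<otimes> v) \<le> len u + len v"
proof -
  obtain xs where "set xs \<subseteq> S" "word_prod W xs = u" "length xs = len u"
    using len_word assms by blast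
  moreover obtain ys where "set ys \<subseteq> S" "word_prod W ys = v" "length ys = len v"
    using len_word assms by blast
  ultimately show ?thesis using len_le[of "xs @ ys"] by auto
qed

lemma len_inv:
  assumes "u \<in> carrier W"
  shows "len (inv u) \<le> len u"
proof -
  obtain xs where "set xs \<subseteq> S" "word_prod W xs = u" "length xs = len u"
    using len_word assms by blast
  then show ?thesis using len_le[of "rev xs"] by (simp add: word_prod_rev)
qed

lemma len_mult_word_le:
  "u \<in> carrier W \<Longrightarrow> set xs \<subseteq> S \<Longrightarrow> len (u \<otimes> word_prod W xs) \<le> len u + length xs"
  using len_mult_le[of u "word_prod W xs"] len_le[of xs] by simp

text \<open>All words for one element have lengths of the same parity, and multiplying by
  \<open>s\<close> switches this parity.\<close>

lemma len_mult_S_neq: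
  assumes "w \<in> carrier W" "s \<in> S"
  shows "len (w \<otimes> s) \<noteq> len w"
proof -
  obtain xs where "set xs \<subseteq> S" "word_prod W xs = w" "length xs = len w"
    using len_word assms by blast
  moreover obtain ys where "set ys \<subseteq> S" "word_prod W ys = w \<otimes> s" "length ys = len (w \<otimes> s)"
    using len_word assms by (metis S_closed m_closed)
  ultimately have "even (length (xs @ [s])) = even (length ys)"
    using assms by (intro cox_equiv_parity S_presents) auto
  then show ?thesis using \<open>length xs = _\<close> \<open>length ys = _\<close> by auto
qed

text \<open>Each letter changes one of the two coefficients, and the change is exactly the recursion
  of \<open>cheb\<close>; the parity of \<open>n\<close> tells which coefficient is the newer
  one.\<close>

lemma word_act_alternating:
  assumes "s \<in> S" "t \<in> S"
  defines "c \<equiv> - cox_form_coeff W s t"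
  shows "word_act W (alternating n t s) (simple_root s) =
    (if even n then (\<lambda>x. cheb c (Suc n) * simple_root s x + cheb c n * simple_root t x)
     else (\<lambda>x. cheb c n * simple_root s x + cheb c (Suc n) * simple_root t x))"
proof (induction n)
  case (Suc n)
  have z: "finite_support (\<lambda>x. 0)" "cox_form W (simple_root r) (\<lambda>x. 0) = 0" for r
    by (auto simp: finite_support_def cox_form_simple_root_left)
  have s: "simple_refl W s (\<lambda>x. a * simple_root s x + b * simple_root t x) =
      (\<lambda>x. (2 * c * b - a) * simple_root s x + b * simple_root t x)" for a b
    using simple_refl_plane[OF assms(1,2) z, of a b] by (simp add: c_def algebra_simps)
  have t: "simple_refl W t (\<lambda>x. a * simple_root s x + b * simple_root t x) =
      (\<lambda>x. a * simple_root s x + (2 * c * a - b) * simple_root t x)" for a b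
    using simple_refl_plane[OF assms(2,1) z, of b a] coeff_sym[OF assms(1,2)]
    by (simp add: c_def algebra_simps)
  show ?case by (simp add: Suc s t)
qed auto

text \<open>The word is the tail of length m + 1 of the relator of length 2m, hence equal in
  \<open>W\<close> to the inverse of the head, which has m - 1 letters.\<close>

lemma word_prod_alternating_long:
  assumes "s \<in> S" "t \<in> S" "cox_m W s t \<noteq> 0"
  shows "len (word_prod W (alternating (cox_m W s t) t s @ [s])) \<le> cox_m W s t - 1"
proof -
  let ?m = "cox_m W s t"
  have "?m - 1 + Suc ?m = 2 * ?m" using assms by auto
  then obtain pre where pre: "alternating (2 * ?m) s t = pre @ alternating (Suc ?m) s t"
    "length pre = ?m - 1" "set pre \<subseteq> {s, t}"
    using alternating_add[of "?m - 1" "Suc ?m" s t] by metis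
  have rel: "word_prod W (concat (replicate n [t, s])) = (t \<otimes> s) [^] n" for n
  proof (induction n)
    case (Suc n)
    then show ?case using assms nat_pow_Suc2[of "t \<otimes> s" n] by (simp add: m_assoc)
  qed simp
  have set: "set pre \<subseteq> S" "set (alternating (Suc ?m) s t) \<subseteq> S"
    using pre(3) assms alternating_in_lists[of s S t "Suc ?m"] by auto
  have "(t \<otimes> s) [^] ?m = \<one>"
    using pow_ord_eq_1[of "t \<otimes> s"] assms unfolding cox_m_sym[OF assms(1,2), symmetric]
    by (simp add: cox_m_def)
  then have "word_prod W pre \<otimes> word_prod W (alternating (Suc ?m) s t) = \<one>"
    using word_prod_append_S[OF set] by (simp only: pre(1)[symmetric] alternating_double rel)
  then have "word_prod W (alternating (Suc ?m) s t) = inv (word_prod W pre)"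
    using set by (metis inv_comm inv_equality word_prod_closed)
  then show ?thesis
    using len_inv[of "word_prod W pre"] len_le[of pre] set pre(2) by (simp only: alternating_snoc) auto
qed

text \<open>Write \<open>w\<close> as \<open>v\<close> times a longest word in \<open>s\<close>,
  \<open>t\<close> with lengths adding up. That word sends \<open>\<alpha>\<^sub>s\<close> to a
  nonnegative combination of \<open>\<alpha>\<^sub>s\<close> and \<open>\<alpha>\<^sub>t\<close>,
  and by induction \<open>v\<close> sends both to nonnegative vectors.\<close>

lemma cox_act_simple_root_nonneg:
  assumes "w \<in> carrier W" "s \<in> S" "len (w \<otimes> s) > len w"
  shows "cox_act W S w (simple_root s) x \<ge> 0"
  using assms
proof (induction "len w" arbitrary: w s x rule: less_induct)
  case less
  obtain zs where zs: "set zs \<subseteq> S" "word_prod W zs = w" "length zs = len w"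
    using len_word less.prems by blast
  show ?case
  proof (cases zs rule: rev_cases)
    case Nil
    then have "cox_act W S w (simple_root s) = simple_root s" using zs by auto
    then show ?thesis by (simp add: simple_root_def)
  next
    case (snoc zs' t)
    have t: "t \<in> S" "set zs' \<subseteq> S" using zs snoc by auto
    define D where "D = (\<lambda>(v, ys). v \<in> carrier W \<and> set ys \<subseteq> {s, t} \<and> w = v \<otimes> word_prod W ys
      \<and> len v + length ys = len w)"
    have "D (word_prod W zs', [t])"
    proof -
      have w: "w = word_prod W zs' \<otimes> word_prod W [t]" using zs snoc t by simp
      have "len w \<le> len (word_prod W zs') + 1"
        using len_mult_word_le[of "word_prod W zs'" "[t]"] w t by simp
      moreover have "len (word_prod W zs') + 1 \<le> len w"
        using len_le[of zs'] t zs snoc by simp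
      ultimately show ?thesis using w t by (simp add: D_def)
    qed
    moreover have "\<forall>p. D p \<longrightarrow> length (snd p) < Suc (len w)"
      unfolding D_def by auto
    \<comment> \<open>The suffix \<open>[t]\<close> shows that a longest suffix is nonempty, which
      makes \<open>v\<close> shorter than \<open>w\<close> and the induction hypothesis
      applicable.\<close>
    ultimately obtain p where "D p" and max: "\<And>p'. D p' \<Longrightarrow> length (snd p') \<le> length (snd p)"
      and ne: "length (snd p) \<ge> 1"
      using ex_has_greatest_nat[of D _ "\<lambda>p. length (snd p)" "Suc (len w)"]
      by (metis One_nat_def length_Cons list.size(3) snd_conv)
    obtain v ys where p: "p = (v, ys)" by (cases p)
    have v: "v \<in> carrier W" and ys: "set ys \<subseteq> {s, t}" and w: "w = v \<otimes> word_prod W ys"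
      and lw: "len v + length ys = len w" using \<open>D p\<close> by (auto simp: p D_def)
    have ysS: "set ys \<subseteq> S" using ys t less.prems by auto
    have ne: "ys \<noteq> []" using ne p by auto
    \<comment> \<open>Otherwise \<open>r\<close> could be moved from the end of \<open>v\<close> to
      the front of \<open>ys\<close>, against maximality.\<close>
    have up: "len (v \<otimes> r) > len v" if "r \<in> {s, t}" for r
    proof (rule ccontr)
      assume "\<not> ?thesis"
      have r: "r \<in> S" using that t less.prems by auto
      with \<open>\<not> ?thesis\<close> have lt: "len (v \<otimes> r) < len v" using len_mult_S_neq[OF v, of r] by auto
      have w': "w = v \<otimes> r \<otimes> word_prod W (r # ys)"
        using w v r ysS by (simp add: m_assoc)
      then have "len w \<le> len (v \<otimes> r) + length (r # ys)"
        using len_mult_word_le[of "v \<otimes> r" "r # ys"] v r ysS by simp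
      then have "D (v \<otimes> r, r # ys)"
        unfolding D_def using w' v r ys that lt lw by auto
      then show False using max[of "(v \<otimes> r, r # ys)"] p by simp
    qed
    have lv: "len v < len w" using lw ne by (simp add: lw[symmetric])
    have pos: "cox_act W S v (simple_root r) x \<ge> 0" if "r \<in> {s, t}" for r
      using that less.hyps[OF lv v _ up[OF that]] t less.prems by auto
    \<comment> \<open>A final \<open>s\<close> would cancel in \<open>ws\<close> and make it shorter
      than \<open>w\<close>.\<close>
    have "last ys \<noteq> s"
    proof
      assume "last ys = s"
      then have e: "ys = butlast ys @ [s]" using ne by (metis append_butlast_last_id)
      have b: "set (butlast ys) \<subseteq> S" using ysS by (meson in_set_butlastD subset_iff)
      have "word_prod W ys \<otimes> s = word_prod W (butlast ys)"
        by (subst e) (use b less.prems in \<open>simp add: m_assoc\<close>)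
      then have "w \<otimes> s = v \<otimes> word_prod W (butlast ys)"
        using w v ysS less.prems by (simp add: m_assoc)
      then have "len (w \<otimes> s) \<le> len v + length (butlast ys)"
        using len_mult_word_le[OF v b] by simp
      then show False using less.prems lw by simp
    qed
    then have st: "s \<noteq> t" and last: "last ys = t" using ys ne last_in_set by blast+
    \<comment> \<open>Since lengths add up, \<open>ys\<close> is reduced, so no two adjacent letters
      cancel.\<close>
    have "ys \<noteq> us @ [r, r] @ vs" for us r vs
    proof
      assume e: "ys = us @ [r, r] @ vs"
      then have "set us \<subseteq> S" "set vs \<subseteq> S" "r \<in> S" using ysS by auto
      then have "w = v \<otimes> word_prod W (us @ vs)" using w e by simp
      then have "len w \<le> len v + length (us @ vs)"
        using len_mult_word_le[OF v, of "us @ vs"] \<open>set us \<subseteq> S\<close> \<open>set vs \<subseteq> S\<close> by simp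
      then show False using lw e by simp
    qed
    then have alt: "ys = alternating (length ys) t s"
      using ys last by (intro alternating_eqI) auto
    let ?m = "cox_m W s t" and ?n = "length ys"
    \<comment> \<open>If \<open>ys\<close> had m letters or more, its last m letters followed by
      \<open>s\<close> could be replaced by m - 1 letters, making \<open>ws\<close> shorter than
      \<open>w\<close>.\<close>
    have short: "?n < ?m" if m: "?m \<noteq> 0"
    proof (rule ccontr)
      assume "\<not> ?thesis"
      then obtain pre where pre: "ys = pre @ alternating ?m t s" "length pre = ?n - ?m"
        using alternating_add[of "?n - ?m" ?m t s] alt by auto
      have set: "set pre \<subseteq> S" "set (alternating ?m t s) \<subseteq> S" using ysS pre(1) by (metis Un_subset_iff set_append)+
      have "w \<otimes> s = v \<otimes> word_prod W (ys @ [s])"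
        using w v ysS less.prems by (simp add: m_assoc)
      also have "ys @ [s] = pre @ (alternating ?m t s @ [s])" using pre(1) by simp
      also have "word_prod W \<dots> = word_prod W pre \<otimes> word_prod W (alternating ?m t s @ [s])"
        using set less.prems by (intro word_prod_append_S) auto
      finally have "w \<otimes> s = (v \<otimes> word_prod W pre) \<otimes> word_prod W (alternating ?m t s @ [s])"
        using v set less.prems by (simp add: m_assoc)
      then have "len (w \<otimes> s) \<le> len (v \<otimes> word_prod W pre) + len (word_prod W (alternating ?m t s @ [s]))"
        using v set less.prems by (simp only:) (intro len_mult_le, auto)
      also have "\<dots> \<le> len v + length pre + (?m - 1)"
        using len_mult_word_le[OF v set(1)] word_prod_alternating_long[OF less.prems(2) t(1) m] by simp
      also have "\<dots> < len w" using pre(2) m lw \<open>\<not> ?n < ?m\<close> by simp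
      finally show False using less.prems by simp
    qed
    let ?c = "- cox_form_coeff W s t"
    \<comment> \<open>Both coefficients needed have index at most \<open>Suc ?n\<close>, hence at
      most m if m is finite. For infinite order c = 1 and \<open>cheb\<close> is the
      identity.\<close>
    have cheb: "cheb ?c k \<ge> 0" if "k \<le> Suc ?n" for k
    proof (cases "?m = 0")
      case True
      then show ?thesis by (simp add: cox_form_coeff_def cheb_one)
    next
      case False
      then show ?thesis using short[OF False] that cox_m_ge_2[OF less.prems(2) t(1) st False]
        by (simp add: cox_form_coeff_def cheb_cos_nonneg)
    qed
    obtain a b where ab: "a \<ge> 0" "b \<ge> 0"
      "word_act W ys (simple_root s) = (\<lambda>x. a * simple_root s x + b * simple_root t x)"
      using word_act_alternating[OF less.prems(2) t(1), of ?n] cheb[of ?n] cheb[of "Suc ?n"] alt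
      by (metis le_SucI order_refl)
    have "cox_act W S w (simple_root s) = cox_act W S v (word_act W ys (simple_root s))"
      using w v ysS by (simp add: cox_act_mult cox_act_word)
    also have "\<dots> = (\<lambda>x. a * cox_act W S v (simple_root s) x + b * cox_act W S v (simple_root t) x)"
      unfolding ab by (rule cox_act_lin[OF v]) auto
    finally show ?thesis using ab pos[of s] pos[of t] by simp
  qed
qed

text \<open>Pass to \<open>ws\<close>: it lengthens when multiplied by \<open>s\<close>, and it
  sends \<open>\<alpha>\<^sub>s\<close> to the negative of its image under \<open>w\<close>.\<close>

lemma cox_act_simple_root_nonpos:
  assumes "w \<in> carrier W" "s \<in> S" "len (w \<otimes> s) < len w"
  shows "cox_act W S w (simple_root s) x \<le> 0"
proof -
  have "cox_act W S (w \<otimes> s) (simple_root s) x \<ge> 0"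
    using assms by (intro cox_act_simple_root_nonneg) (auto simp: m_assoc)
  moreover have "cox_act W S (w \<otimes> s) (simple_root s) = neg_root (cox_act W S w (simple_root s))"
    using assms by (simp add: cox_act_mult cox_act_S simple_refl_simple_root cox_act_neg)
  ultimately show ?thesis by (simp add: neg_root_def)
qed

text \<open>The last letter of a shortest word for \<open>w\<close> works. This is the faithfulness
  of the representation in the form used below.\<close>

lemma exists_nonpos_simple_root:
  assumes "w \<in> carrier W" "w \<noteq> \<one>"
  obtains s where "s \<in> S" "\<And>x. cox_act W S w (simple_root s) x \<le> 0"
proof -
  obtain zs where zs: "set zs \<subseteq> S" "word_prod W zs = w" "length zs = len w"
    using len_word assms by blast
  with assms obtain zs' t where z: "zs = zs' @ [t]" by (cases zs rule: rev_cases) auto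
  then have "w \<otimes> t = word_prod W zs'" using zs by (auto simp: m_assoc)
  then have "len (w \<otimes> t) < len w" using len_le[of zs'] zs z by auto
  then show ?thesis using that[of t] cox_act_simple_root_nonpos[OF assms(1)] zs z by auto
qed

subsection \<open>Roots and reflections\<close>

text \<open>Conjugating the reflection formula by \<open>g\<close> moves its direction to the image
  of \<open>\<alpha>\<^sub>s\<close>; the scalar is twice the form of
  \<open>\<alpha>\<^sub>s\<close> with \<open>inv g\<close> applied to \<open>v\<close>.\<close>

lemma cox_act_conj:
  assumes "g \<in> carrier W" "s \<in> S" "finite_support v"
  shows "\<exists>k. cox_act W S (g \<otimes> s \<otimes> inv g) v = (\<lambda>x. v x - k * cox_act W S g (simple_root s) x)"
proof -
  let ?u = "cox_act W S (inv g) v"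
  let ?k = "2 * cox_form W (simple_root s) ?u"
  have "cox_act W S (g \<otimes> s \<otimes> inv g) v = cox_act W S g (\<lambda>x. 1 * ?u x + (- ?k) * simple_root s x)"
    using assms by (simp add: cox_act_mult cox_act_S simple_refl_def)
  also have "\<dots> = (\<lambda>x. 1 * cox_act W S g ?u x + (- ?k) * cox_act W S g (simple_root s) x)"
    using assms by (intro cox_act_lin) auto
  finally show ?thesis using assms by auto
qed

lemma cox_act_simple_root_nonzero:
  assumes "w \<in> carrier W"
  shows "cox_act W S w (simple_root s) \<noteq> (\<lambda>x. 0)"
proof
  assume "cox_act W S w (simple_root s) = (\<lambda>x. 0)"
  then have "cox_act W S (inv w) (\<lambda>x. 0 * simple_root s x) = simple_root s"
    using cox_act_inv(1)[OF assms, of "simple_root s"] by simp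
  then have "(\<lambda>x. 0) = simple_root s" using cox_act_scale[of "inv w" "simple_root s" 0] assms by simp
  then show False by (auto simp: simple_root_def fun_eq_iff split: if_splits)
qed

text \<open>This recovers a reflection from its root. The scalar \<open>c\<close> is left open
  because callers know the root only up to proportionality.\<close>

lemma conj_eq_if_cox_act_simple_root:
  assumes g: "g \<in> carrier W" and s: "s \<in> S" and s': "s' \<in> S"
    and eq: "cox_act W S g (simple_root s) = (\<lambda>x. c * simple_root s' x)"
  shows "g \<otimes> s \<otimes> inv g = s'"
proof (rule ccontr)
  assume neq: "g \<otimes> s \<otimes> inv g \<noteq> s'"
  \<comment> \<open>\<open>h\<close> is unipotent, as both \<open>s'\<close> and \<open>g s g\<inverse>\<close> negate \<open>\<alpha>\<^sub>s\<^sub>'\<close> and change vectors only by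
    multiples of it. So it makes no simple root negative, which forces \<open>h = 1\<close>.\<close>
  define r where "r = g \<otimes> s \<otimes> inv g"
  define h where "h = s' \<otimes> r"
  have carr: "r \<in> carrier W" "h \<in> carrier W" using assms by (auto simp: r_def h_def)
  have "h \<noteq> \<one>"
  proof
    assume "h = \<one>"
    then have "s' \<otimes> h = s'" using s' by simp
    then show False using neq carr s' by (simp add: h_def r_def)
  qed
  then obtain t where t: "t \<in> S" "\<And>x. cox_act W S h (simple_root t) x \<le> 0"
    using exists_nonpos_simple_root carr by blast
  have c: "c \<noteq> 0" using cox_act_simple_root_nonzero[OF g, of s] eq by auto
  have "cox_act W S r (\<lambda>x. c * simple_root s' x) = neg_root (\<lambda>x. c * simple_root s' x)"
    unfolding eq[symmetric] r_def using g s
    by (simp add: cox_act_mult cox_act_S simple_refl_simple_root cox_act_neg)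
  then have "(\<lambda>x. c * cox_act W S r (simple_root s') x) = (\<lambda>x. c * neg_root (simple_root s') x)"
    using cox_act_scale[OF carr(1), of "simple_root s'" c] by (simp add: neg_root_def)
  then have "cox_act W S r (simple_root s') = neg_root (simple_root s')"
    using c by (simp add: fun_eq_iff)
  then have hs': "cox_act W S h (simple_root s') = simple_root s'"
    unfolding h_def using s' carr
    by (simp add: cox_act_mult cox_act_neg cox_act_S simple_refl_simple_root) (simp add: neg_root_def)
  obtain k where k: "cox_act W S r (simple_root t) = (\<lambda>x. simple_root t x - k * (c * simple_root s' x))"
    using cox_act_conj[OF g s, of "simple_root t"] eq r_def by auto
  show False
  \<comment> \<open>In both cases the image of \<open>\<alpha>\<^sub>t\<close> under
    \<open>h\<close> has coordinate 1 at \<open>t\<close>, which contradicts the choice of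
    \<open>t\<close>.\<close>
  proof (cases "t = s'")
    case True
    then show False using t(2)[of t] hs' by (simp add: simple_root_def)
  next
    case False
    have "cox_act W S h (simple_root t) t = 1"
      unfolding h_def using carr s' False
      by (simp add: cox_act_mult k cox_act_S finite_support_intros simple_refl_def)
         (simp add: simple_root_def)
    then show False using t(2)[of t] by simp
  qed
qed

lemma neg_root_neg_root [simp]: "neg_root (neg_root v) = v"
  by (simp add: neg_root_def)

lemma cox_act_in_roots: "w \<in> carrier W \<Longrightarrow> s \<in> S \<Longrightarrow> cox_act W S w (simple_root s) \<in> roots W S"
  unfolding roots_def by auto

lemma simple_root_in_pos_roots: "s \<in> S \<Longrightarrow> simple_root s \<in> pos_roots W S"
  using cox_act_in_roots[of \<one> s] by (auto simp: pos_roots_def) (simp add: simple_root_def)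

lemma roots_pos_or_neg:
  assumes "\<beta> \<in> roots W S"
  shows "\<beta> \<in> pos_roots W S \<or> \<beta> \<in> neg_root ` pos_roots W S"
proof -
  obtain w s where w: "w \<in> carrier W" "s \<in> S" "\<beta> = cox_act W S w (simple_root s)"
    using assms unfolding roots_def by auto
  show ?thesis
  proof (cases "len (w \<otimes> s) > len w")
    case True
    then show ?thesis using cox_act_simple_root_nonneg w assms by (auto simp: pos_roots_def)
  next
    case False
    then have "len (w \<otimes> s) < len w" using len_mult_S_neq[OF w(1,2)] by simp
    then have "\<forall>x. 0 \<le> neg_root \<beta> x"
      using cox_act_simple_root_nonpos w by (auto simp: neg_root_def)
    moreover have "neg_root \<beta> = cox_act W S (w \<otimes> s) (simple_root s)"
      using w by (simp add: cox_act_mult cox_act_S simple_refl_simple_root cox_act_neg)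
    then have "neg_root \<beta> \<in> roots W S" using cox_act_in_roots w by simp
    ultimately have "neg_root \<beta> \<in> pos_roots W S" by (simp add: pos_roots_def)
    then show ?thesis by (metis image_eqI neg_root_neg_root)
  qed
qed

text \<open>For uniqueness, a reflection changes vectors only by multiples of its own root, so a
  root that it negates is proportional to that root. Moving both roots back by \<open>inv u\<close>
  reduces to the case of a simple root.\<close>

lemma refl_of_root_eq:
  assumes w: "w \<in> carrier W" and s: "s \<in> S"
  shows "refl_of_root W S (cox_act W S w (simple_root s)) = w \<otimes> s \<otimes> inv w"
  unfolding refl_of_root_def
proof (rule the_equality)
  let ?b = "cox_act W S w (simple_root s)"
  show "w \<otimes> s \<otimes> inv w \<in> reflections W S \<and> cox_act W S (w \<otimes> s \<otimes> inv w) ?b = neg_root ?b"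
    using assms by (auto simp: reflections_def cox_act_mult cox_act_S simple_refl_simple_root cox_act_neg)
  fix r assume r: "r \<in> reflections W S \<and> cox_act W S r ?b = neg_root ?b"
  then obtain u s' where u: "u \<in> carrier W" "s' \<in> S" "r = u \<otimes> s' \<otimes> inv u"
    unfolding reflections_def by auto
  let ?c = "cox_act W S u (simple_root s')"
  obtain k where "cox_act W S r ?b = (\<lambda>x. ?b x - k * ?c x)"
    using cox_act_conj[OF u(1,2), of ?b] u(3) w by auto
  then have "neg_root ?b = (\<lambda>x. ?b x - k * ?c x)" using r by simp
  then have "2 * ?b x = k * ?c x" for x
    by (drule_tac x = x in fun_cong) (simp add: neg_root_def)
  then have "?b x = k / 2 * ?c x" for x by (simp add: field_simps)
  then have "?b = (\<lambda>x. k / 2 * ?c x)" by (rule ext)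
  then have "cox_act W S (inv u \<otimes> w) (simple_root s) = cox_act W S (inv u) (\<lambda>x. k / 2 * ?c x)"
    using u w by (simp only: cox_act_mult inv_closed finite_support_simple_root)
  also have "\<dots> = (\<lambda>x. k / 2 * cox_act W S (inv u) ?c x)"
    using u by (intro cox_act_scale) auto
  finally have "cox_act W S (inv u \<otimes> w) (simple_root s) = (\<lambda>x. k / 2 * simple_root s' x)"
    using u by simp
  then have "(inv u \<otimes> w) \<otimes> s \<otimes> inv (inv u \<otimes> w) = s'"
    using u w s by (intro conj_eq_if_cox_act_simple_root[where c = "k / 2"]) auto
  then have "inv u \<otimes> (w \<otimes> s \<otimes> inv w) \<otimes> u = s'"
    using u w s by (simp add: inv_mult_group m_assoc)
  then show "r = w \<otimes> s \<otimes> inv w"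
    using conj_inv_conj[of "inv u" "w \<otimes> s \<otimes> inv w"] u w s by simp
qed

lemma refl_of_root_simple_root: "s \<in> S \<Longrightarrow> refl_of_root W S (simple_root s) = s"
  using refl_of_root_eq[of \<one> s] by simp

lemma refl_of_root_in_reflections:
  "\<beta> \<in> roots W S \<Longrightarrow> refl_of_root W S \<beta> \<in> reflections W S"
  unfolding roots_def using refl_of_root_eq by (auto simp: reflections_def)

lemma reflections_closed: "r \<in> reflections W S \<Longrightarrow> r \<in> carrier W"
  by (auto simp: reflections_def)

section \<open>Depth of roots and of group elements\<close>

lemma root_depth_simple_root: "s \<in> S \<Longrightarrow> root_depth W S (simple_root s) \<le> 1"
  unfolding root_depth_def
  by (rule Least_le, rule bexI[of _ "[s]"])
     (auto simp: simple_refl_simple_root simple_root_in_pos_roots)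

lemma len_refl_of_root:
  assumes "\<beta> \<in> pos_roots W S"
  shows "len (refl_of_root W S \<beta>) + 1 \<le> 2 * root_depth W S \<beta>"
proof -
  have "\<beta> \<in> roots W S" using assms by (simp add: pos_roots_def)
  then obtain w s where w: "w \<in> carrier W" "s \<in> S" "\<beta> = cox_act W S w (simple_root s)"
    unfolding roots_def by auto
  let ?P = "\<lambda>k. \<exists>xs \<in> lists S. length xs = k \<and> word_act W xs \<beta> \<in> neg_root ` pos_roots W S"
  \<comment> \<open>The minimum is attained once some word works: \<open>inv w\<close> carries
    \<beta> to \<open>\<alpha>\<^sub>s\<close>, and \<open>s\<close> then negates it.\<close>
  have "\<exists>k. ?P k"
  proof -
    obtain zs where zs: "set zs \<subseteq> S" "word_prod W zs = inv w"
      using word_obtain[of "inv w"] w(1) by auto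
    then have "word_act W zs \<beta> = simple_root s"
      using cox_act_word[of zs \<beta>] w by simp
    then have "word_act W (s # zs) \<beta> = neg_root (simple_root s)"
      using w by (simp add: simple_refl_simple_root)
    then show ?thesis using zs w simple_root_in_pos_roots[of s]
      by (intro exI[of _ "length (s # zs)"] bexI[of _ "s # zs"]) auto
  qed
  then have "?P (root_depth W S \<beta>)" unfolding root_depth_def by (rule LeastI_ex)
  then obtain xs where xs: "set xs \<subseteq> S" "length xs = root_depth W S \<beta>"
    "word_act W xs \<beta> \<in> neg_root ` pos_roots W S" by auto
  \<comment> \<open>A root is nonzero, so it cannot be both positive and negative.\<close>
  have "xs \<noteq> []"
  proof
    assume "xs = []"
    then have "\<beta> \<in> neg_root ` pos_roots W S" using xs by simp
    then have "\<beta> x \<le> 0" for x by (auto simp: neg_root_def pos_roots_def)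
    moreover have "\<beta> x \<ge> 0" for x using assms by (auto simp: pos_roots_def)
    ultimately have "\<beta> = (\<lambda>x. 0)" by (metis order_antisym ext)
    then show False using cox_act_simple_root_nonzero[OF w(1)] w(3) by simp
  qed
  then obtain r ys where x: "xs = r # ys" by (cases xs) auto
  then have rS: "r \<in> S" and ysS: "set ys \<subseteq> S" using xs by auto
  define \<gamma> where "\<gamma> = word_act W ys \<beta>"
  define g where "g = word_prod W ys"
  have g: "g \<in> carrier W" using ysS by (simp add: g_def)
  have \<gamma>: "\<gamma> = cox_act W S (g \<otimes> w) (simple_root s)"
    unfolding \<gamma>_def g_def using w ysS by (simp add: cox_act_mult cox_act_word)
  have "\<gamma> \<notin> neg_root ` pos_roots W S"
  proof
    assume "\<gamma> \<in> neg_root ` pos_roots W S"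
    then have "root_depth W S \<beta> \<le> length ys"
      unfolding root_depth_def \<gamma>_def using ysS by (intro Least_le bexI[of _ ys]) auto
    then show False using xs x by simp
  qed
  moreover have "\<gamma> \<in> roots W S" using \<gamma> cox_act_in_roots g w by simp
  ultimately have "\<gamma> \<in> pos_roots W S" using roots_pos_or_neg by blast
  then have pos: "\<gamma> x \<ge> 0" for x by (simp add: pos_roots_def)
  have neg: "simple_refl W r \<gamma> x \<le> 0" for x
    using xs(3) x by (auto simp: \<gamma>_def[symmetric] neg_root_def pos_roots_def)
  \<comment> \<open>\<open>r\<close> changes only the coordinate at \<open>r\<close>; every other
    coordinate of \<gamma> is both nonnegative and nonpositive.\<close>
  have "\<gamma> x = \<gamma> r * simple_root r x" for x
    using neg[of x] pos[of x] by (cases "x = r") (auto simp: simple_refl_def simple_root_def)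
  then have "cox_act W S (g \<otimes> w) (simple_root s) = (\<lambda>x. \<gamma> r * simple_root r x)"
    unfolding \<gamma>[symmetric] by (rule ext)
  then have "(g \<otimes> w) \<otimes> s \<otimes> inv (g \<otimes> w) = r"
    using g w rS by (intro conj_eq_if_cox_act_simple_root) auto
  then have "g \<otimes> (w \<otimes> s \<otimes> inv w) \<otimes> inv g = r"
    using g w by (simp add: inv_mult_group m_assoc)
  then have "w \<otimes> s \<otimes> inv w = inv g \<otimes> r \<otimes> g"
    using conj_inv_conj[OF g, of "w \<otimes> s \<otimes> inv w"] w by simp
  also have "\<dots> = word_prod W (rev ys @ [r] @ ys)"
    using rS ysS by (simp add: word_prod_rev g_def m_assoc)
  finally have "refl_of_root W S \<beta> = word_prod W (rev ys @ [r] @ ys)"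
    using refl_of_root_eq w by simp
  then have "len (refl_of_root W S \<beta>) \<le> length (rev ys @ [r] @ ys)"
    using len_le[of "rev ys @ [r] @ ys"] ysS rS by simp
  then show ?thesis using xs(2) x by simp
qed

text \<open>Each factor adds 1 to the count and at most 2 dp(\<beta>) - 1 to the length. Membership
  in the carrier is proved along with it, for subadditivity of the length.\<close>

lemma len_word_prod_refl_of_root:
  assumes "set \<beta>s \<subseteq> pos_roots W S"
  shows "length \<beta>s + len (word_prod W (map (refl_of_root W S) \<beta>s)) \<le>
      2 * sum_list (map (root_depth W S) \<beta>s)
    \<and> word_prod W (map (refl_of_root W S) \<beta>s) \<in> carrier W"
  using assms
proof (induction \<beta>s)
  case Nil
  then show ?case using len_le[of "[]"] by simp
next
  case (Cons \<beta> \<beta>s)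
  have c: "refl_of_root W S \<beta> \<in> carrier W"
    using Cons.prems refl_of_root_in_reflections reflections_closed by (auto simp: pos_roots_def)
  show ?case
    using Cons len_refl_of_root[of \<beta>] c
      len_mult_le[of "refl_of_root W S \<beta>" "word_prod W (map (refl_of_root W S) \<beta>s)"] by auto
qed

text \<open>A shortest word is read as a product of reflections in simple roots. The bound comes
  with an explicit decomposition, so it also shows that the minimum in \<open>cox_depth\<close> is
  attained.\<close>

lemma cox_depth_le:
  assumes "w \<in> carrier W"
  shows "\<exists>n \<le> len w. \<exists>\<beta>s \<in> lists (pos_roots W S).
    w = word_prod W (map (refl_of_root W S) \<beta>s) \<and> n = sum_list (map (root_depth W S) \<beta>s)"
proof -
  obtain xs where xs: "set xs \<subseteq> S" "word_prod W xs = w" "length xs = len w"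
    using len_word assms by blast
  have "map (refl_of_root W S) (map simple_root xs) = xs"
    using xs(1) by (induction xs) (auto simp: refl_of_root_simple_root)
  moreover have "sum_list (map (root_depth W S) (map simple_root xs)) \<le> length xs"
    using xs(1)
  proof (induction xs)
    case (Cons y ys)
    then show ?case using root_depth_simple_root[of y] by simp
  qed simp
  moreover have "map simple_root xs \<in> lists (pos_roots W S)"
    using xs(1) simple_root_in_pos_roots by (auto simp: subset_iff)
  ultimately show ?thesis using xs by metis
qed

end

theorem mainTheorem4:
  fixes W :: "('a, 'b) monoid_scheme" and S :: "'a set" and w :: 'a
  assumes "coxeter_system W S"
    and "w \<in> carrier W"
  shows "(real (reflection_length W S w) + real (cox_length W S w)) / 2 \<le> real (cox_depth W S w) \<and>
    cox_depth W S w \<le> cox_length W S w"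
proof -
  interpret coxeter_system W S by (rule assms)
  let ?Q = "\<lambda>n. \<exists>\<beta>s \<in> lists (pos_roots W S).
       w = word_prod W (map (refl_of_root W S) \<beta>s) \<and> n = sum_list (map (root_depth W S) \<beta>s)"
  obtain n where n: "n \<le> cox_length W S w" "?Q n" using cox_depth_le[OF assms(2)] by blast
  have upper: "cox_depth W S w \<le> cox_length W S w"
    using Least_le[of ?Q, OF n(2)] n(1) unfolding cox_depth_def by simp
  have "?Q (cox_depth W S w)" unfolding cox_depth_def using n(2) by (rule LeastI)
  then obtain \<beta>s where b: "set \<beta>s \<subseteq> pos_roots W S" "w = word_prod W (map (refl_of_root W S) \<beta>s)"
    "cox_depth W S w = sum_list (map (root_depth W S) \<beta>s)" by auto
  have "map (refl_of_root W S) \<beta>s \<in> lists (reflections W S)"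
    using b(1) refl_of_root_in_reflections by (auto simp: pos_roots_def subset_iff)
  then have "reflection_length W S w \<le> length \<beta>s"
    unfolding reflection_length_def b(2) using word_length_le[of "map (refl_of_root W S) \<beta>s"] by simp
  moreover have "length \<beta>s + cox_length W S w \<le> 2 * cox_depth W S w"
    using len_word_prod_refl_of_root[OF b(1)] unfolding b(3) b(2)[symmetric] by blast
  ultimately have "reflection_length W S w + cox_length W S w \<le> 2 * cox_depth W S w" by linarith
  then show ?thesis using upper by simp
qed

end
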